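(* Let $\mathfrak{e}\subset\mathbb{R}$ be an infinite compact set, $x_-=\inf\mathfrak{e}$, $x_+=\sup\mathfrak{e}$, let $x_0$ lie in a bounded connected component of $\mathbb{R}\setminus\mathfrak{e}$, and let $n\in\mathbb{N}$, $n\ge 1$. Let $\{x_j\}_{j=1}^{n+1}\subset\mathfrak{e}$ be an $x_0$-alternating set for the residual polynomial $R_{x_0,n}$ of $\mathfrak{e}$, with associated integer $k$, $1\le k\le n$, so that $x_k<x_0<x_{k+1}$. Then: (a) $R_{x_0,n}$ has at least $n-1$ zeros in $(x_-,x_k)\cup(x_{k+1},x_+)$ and no zeros in $[x_k,x_{k+1}]$. (b) $\deg(R_{x_0,n})$ is either $n$ or $n-1$. (c) All zeros of $R_{x_0,n}$ are real and simple.
   Context: $\|f\|_{\mathfrak{e}}=\sup_{z\in\mathfrak{e}}|f(z)|$. The residual polynomial $R_{x_0,n}$ is the unique polynomial minimizing $\|P\|_{\mathfrak{e}}$ among all polynomials $P$ of degree at most $n$ with $P(x_0)=1$. A polynomial $P$ of degree at most $n$ has an $x_0$-alternating set in $\mathfrak{e}$ if there are $n+1$ points $\{x_j\}_{j=1}^{n+1}\subset\mathfrak{e}$ with $x_1<\dots<x_k<x_0<x_{k+1}<\dots<x_{n+1}$ for some $k\in\{0,1,\dots,n+1\}$ such that $P(x_j)=(-1)^{k+1-j}\,\mathrm{sgn}(x_j-x_0)\,\|P\|_{\mathfrak{e}}$ for $j=1,\dots,n+1$. Known facts (Achieser's alternation theorem): $R_{x_0,n}$ has an $x_0$-alternating set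 in $\mathfrak{e}$, and any polynomial of degree at most $n$ with an $x_0$-alternating set in $\mathfrak{e}$ and value $1$ at $x_0$ equals $R_{x_0,n}$. When $x_0$ lies in a bounded component of $\mathbb{R}\setminus\mathfrak{e}$, one has $1\le k\le n$. *)

theory Defs
  imports "HOL-Computational_Algebra.Polynomial" "HOL-Analysis.Analysis"
begin

definition sup_norm :: "real set \<Rightarrow> complex poly \<Rightarrow> real" where
  "sup_norm e P = (SUP t\<in>e. cmod (poly P (of_real t)))"

(* Polynomials have complex coefficients, so the minimum is taken over all of them; uniqueness
   of the minimizer is a theorem about compact infinite e and is not built into the predicate. *)
definition residual_poly :: "real set \<Rightarrow> real \<Rightarrow> nat \<Rightarrow> complex poly \<Rightarrow> bool" where
  "residual_poly e x0 n R \<longleftrightarrow>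
     is_arg_min (sup_norm e) (\<lambda>P. degree P \<le> n \<and> poly P (of_real x0) = 1) R"

(* The points are x 1, ..., x (n + 1); other values of x are irrelevant. For k = 0 or k = n + 1
   all points lie on one side of x0. The exponent k + 1 - j may be negative, hence powi. *)
definition alternating_set ::
    "real set \<Rightarrow> real \<Rightarrow> nat \<Rightarrow> complex poly \<Rightarrow> nat \<Rightarrow> (nat \<Rightarrow> real) \<Rightarrow> bool" where
  "alternating_set e x0 n P k x \<longleftrightarrow>
     degree P \<le> n \<and> k \<le> n + 1 \<and>
     x ` {1..n+1} \<subseteq> e \<and> strict_mono_on {1..n+1} x \<and>
     (\<forall>j\<in>{1..k}. x j < x0) \<and> (\<forall>j\<in>{k+1..n+1}. x0 < x j) \<and>
     (\<forall>j\<in>{1..n+1}. poly P (of_real (x j)) =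
        of_real ((-1) powi (int k + 1 - int j) * sgn (x j - x0) * sup_norm e P))"

end

theory Submission
  imports Defs
begin

text \<open>
  The values of \<open>R\<close> at the \<open>n + 1\<close> alternation points are real, so \<open>R\<close> has real coefficients.
  \<open>R\<close> changes sign between any two consecutive alternation points except \<open>x\<^sub>k\<close> and \<open>x\<^sub>k\<^sub>+\<^sub>1\<close>,
  which yields \<open>n - 1\<close> zeros. Dividing out the corresponding linear factors leaves a real factor
  of degree at most \<open>1\<close> whose sign is the same at all alternation points. A possible last zero
  therefore lies outside \<open>[x\<^sub>1, x\<^sub>n\<^sub>+\<^sub>1]\<close>; in particular it differs from the others and is not in
  \<open>[x\<^sub>k, x\<^sub>k\<^sub>+\<^sub>1]\<close>.
\<close>

section \<open>Roots counted against the degree\<close>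

lemma prod_linear_factors_dvd:
  fixes p :: "'a :: idom poly"
  assumes "finite A" "\<And>a. a \<in> A \<Longrightarrow> poly p a = 0"
  shows "(\<Prod>a\<in>A. [:- a, 1:]) dvd p"
  using assms
proof (induction A rule: finite_induct)
  case (insert a A)
  then obtain q where q: "p = (\<Prod>a\<in>A. [:- a, 1:]) * q" by (auto elim: dvdE)
  have "poly (\<Prod>a\<in>A. [:- a, 1:]) a \<noteq> 0"
    using insert.hyps by (auto simp: poly_prod)
  then have "poly q a = 0"
    using insert.prems[of a] by (simp add: q)
  then have "[:- a, 1:] dvd q" by (simp add: poly_eq_0_iff_dvd)
  then have "(\<Prod>a\<in>A. [:- a, 1:]) * [:- a, 1:] dvd p" unfolding q by (rule mult_dvd_mono[OF dvd_refl])
  then show ?case using insert.hyps by (simp add: mult.commute)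
qed simp

text \<open>The orders of the roots sum to at most the degree, and each is at least 1. Once there
  are \<open>degree p\<close> distinct roots, a multiple root would push the sum beyond this
  bound.\<close>

lemma order_eq_1_of_card_roots_eq_degree:
  fixes p :: "'a :: idom poly"
  assumes "p \<noteq> 0" "card {z. poly p z = 0} = degree p" "poly p z = 0"
  shows "order z p = 1"
proof (rule ccontr)
  let ?Z = "{z. poly p z = 0}"
  assume "order z p \<noteq> 1"
  then have "1 < order z p"
    using assms by (metis less_one linorder_neqE_nat order_root)
  moreover have "1 \<le> order w p" if "w \<in> ?Z" for w
    using that assms(1) by (simp add: order_root Suc_le_eq)
  ultimately have "(\<Sum>w\<in>?Z. 1) < (\<Sum>w\<in>?Z. order w p)"
    using assms(3) poly_roots_finite[OF assms(1)] by (intro sum_strict_mono_ex1) blast+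
  also have "\<dots> \<le> degree p" by (rule sum_order_le_degree[OF assms(1)])
  finally show False using assms(2) by simp
qed

lemma roots_eq_of_card_eq_degree:
  fixes p :: "'a :: idom poly"
  assumes "p \<noteq> 0" "A \<subseteq> {z. poly p z = 0}" "card A = degree p"
  shows "{z. poly p z = 0} = A"
proof -
  have "finite {z. poly p z = 0}" using assms(1) by (rule poly_roots_finite)
  then show ?thesis
    using assms card_poly_roots_bound[OF assms(1)] card_seteq by metis
qed

section \<open>Passing between real and complex coefficients\<close>

lemma poly_map_poly_Re: "poly (map_poly Re p) t = Re (poly p (of_real t))"
  by (induction p) (auto simp: map_poly_pCons)

lemma poly_map_poly_of_real:
  "poly (map_poly of_real p) (of_real t) = (of_real (poly p t) :: complex)"
  by (induction p) (auto simp: map_poly_pCons)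

text \<open>At a real point, taking real parts of the coefficients takes the real part of the value.
  Hence both polynomials agree on \<open>A\<close>, which has more points than either
  degree.\<close>

lemma real_coeffs_of_real_values:
  fixes p :: "complex poly"
  assumes "degree p < card A" "\<And>t. t \<in> A \<Longrightarrow> poly p (of_real t) \<in> \<real>"
  shows "p = map_poly of_real (map_poly Re p)"
proof (rule poly_eqI_degree)
  fix z :: complex assume "z \<in> of_real ` A"
  then show "poly p z = poly (map_poly of_real (map_poly Re p)) z"
    using assms(2) by (auto simp: poly_map_poly_of_real poly_map_poly_Re)
next
  have card: "card (of_real ` A :: complex set) = card A" by (rule card_image) (simp add: inj_on_def)
  then show "degree p < card (of_real ` A :: complex set)" using assms(1) by simp
  have "degree (map_poly of_real (map_poly Re p) :: complex poly) \<le> degree p"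
    by (intro order_trans[OF map_poly_degree_leq] map_poly_degree_leq) simp_all
  then show "degree (map_poly of_real (map_poly Re p) :: complex poly) < card (of_real ` A :: complex set)"
    using assms(1) card by simp
qed

section \<open>Real polynomials with prescribed sign changes\<close>

lemma degree_le_1_no_root_between:
  fixes q :: "real poly"
  assumes "degree q \<le> 1" "poly q a * poly q b > 0" "a \<le> t" "t \<le> b"
  shows "poly q t \<noteq> 0"
proof
  assume 0: "poly q t = 0"
  obtain c d where q: "q = [:c, d:]"
  proof (cases "degree q = 0")
    case True
    then show ?thesis using that[of _ 0] by (auto elim!: degree_eq_zeroE)
  next
    case False
    then show ?thesis using assms(1) that by (metis degree1_coeffs le_antisym less_one not_le)
  qed
  have c: "c = - (t * d)" using 0 by (simp add: q)
  \<comment> \<open>With the root \<open>t\<close> the polynomial is \<open>d\<close> times (X -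
    \<open>t\<close>), and \<open>t\<close> separates \<open>a\<close> from \<open>b\<close>, so the
    two values cannot have the same strict sign.\<close>
  have "poly q a * poly q b = d\<^sup>2 * ((a - t) * (b - t))"
    by (simp add: q c power2_eq_square algebra_simps)
  moreover have "(a - t) * (b - t) \<le> 0"
    using assms(3,4) by (simp add: mult_nonpos_nonneg)
  ultimately have "poly q a * poly q b \<le> 0"
    by (simp add: mult_nonneg_nonpos)
  then show False using assms(2) by simp
qed

text \<open>This isolates what alternation contributes: only signs at the points, with no norm and
  no \<open>x0\<close>. The last conclusion is stated as a count because \<open>degree r\<close>
  distinct real roots leave no room for nonreal or multiple roots over the complex numbers.\<close>

lemma sign_pattern_roots:
  fixes r :: "real poly" and x :: "nat \<Rightarrow> real"
  assumes mono: "strict_mono_on {1..n+1} x" and k: "1 \<le> k" "k \<le> n"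
    and deg: "degree r \<le> n"
    and change: "\<And>j. j \<in> {1..n} - {k} \<Longrightarrow> poly r (x j) * poly r (x (j+1)) < 0"
    and keep: "poly r (x k) * poly r (x (k+1)) > 0"
  shows "\<exists>Z. Z \<subseteq> {x 1<..<x k} \<union> {x (k+1)<..<x (n+1)} \<and> card Z = n - 1 \<and> (\<forall>t\<in>Z. poly r t = 0)"
    and "\<forall>t\<in>{x k..x (k+1)}. poly r t \<noteq> 0"
    and "card {t. poly r t = 0} = degree r"
proof -
  define J where "J = {1..n} - {k}"
  have finJ: "finite J" and cardJ: "card J = n - 1" using k by (auto simp: J_def)
  have less: "x i < x j" if "1 \<le> i" "i < j" "j \<le> n+1" for i j
    using mono that by (auto simp: strict_mono_on_def)
  have le: "x i \<le> x j" if "1 \<le> i" "i \<le> j" "j \<le> n+1" for i j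
    using less[of i j] that by (cases "i = j") auto
  have "\<exists>t. x j < t \<and> t < x (j+1) \<and> poly r t = 0" if "j \<in> J" for j
  proof -
    have "x j < x (j+1)" using that by (intro less) (auto simp: J_def)
    then show ?thesis using poly_IVT[OF _ change[of j]] that by (auto simp: J_def)
  qed
  then obtain z where z: "\<And>j. j \<in> J \<Longrightarrow> x j < z j \<and> z j < x (j+1) \<and> poly r (z j) = 0"
    by metis
  \<comment> \<open>Each \<open>z i\<close> lies between \<open>x i\<close> and
    \<open>x (i+1)\<close>. Its position relative to every other \<open>x j\<close> gives
    injectivity of \<open>z\<close>, the location of the roots and the signs of the factors of
    \<open>p\<close>.\<close>
  have below: "z i < x j" if "i \<in> J" "i < j" "j \<le> n+1" for i j
    using z[OF that(1)] le[of "i+1" j] that by (auto simp: J_def)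
  have above: "x j < z i" if "i \<in> J" "1 \<le> j" "j \<le> i" for i j
    using z[OF that(1)] le[of j i] that by (auto simp: J_def)
  have inj: "inj_on z J"
  proof (rule linorder_inj_onI)
    fix i j assume "i < j" "i \<in> J" "j \<in> J"
    then show "z i \<noteq> z j" using below[of i j] above[of j j] by (auto simp: J_def)
  qed auto
  let ?Z = "z ` J"
  have cardZ: "card ?Z = n - 1" using card_image[OF inj] cardJ by simp
  have Z0: "\<And>t. t \<in> ?Z \<Longrightarrow> poly r t = 0" using z by auto
  have Zloc: "?Z \<subseteq> {x 1<..<x k} \<union> {x (k+1)<..<x (n+1)}"
  proof
    fix t assume "t \<in> ?Z"
    then obtain i where i: "i \<in> J" "t = z i" by auto
    show "t \<in> {x 1<..<x k} \<union> {x (k+1)<..<x (n+1)}"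
    proof (cases "i < k")
      case True
      then show ?thesis using i k below[of i k] above[of i 1] by (auto simp: J_def)
    next
      case False
      then have "k + 1 \<le> i" using i by (auto simp: J_def)
      then show ?thesis using i k below[of i "n+1"] above[of i "k+1"] by (auto simp: J_def)
    qed
  qed
  show "\<exists>Z. Z \<subseteq> {x 1<..<x k} \<union> {x (k+1)<..<x (n+1)} \<and> card Z = n - 1 \<and> (\<forall>t\<in>Z. poly r t = 0)"
    using Zloc cardZ Z0 by blast

  define p where "p = (\<Prod>a\<in>?Z. [:- a, 1:])"
  have p: "poly p t = (\<Prod>i\<in>J. t - z i)" for t
    by (simp add: p_def poly_prod prod.reindex[OF inj])
  have proots: "poly p t = 0 \<longleftrightarrow> t \<in> ?Z" for t
    using finJ by (auto simp: p)
  have p0: "p \<noteq> 0" using finJ by (auto simp: p_def)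
  have degp: "degree p = n - 1"
    using cardZ by (simp add: p_def degree_prod_eq_sum_degree)
  have "p dvd r"
    unfolding p_def by (rule prod_linear_factors_dvd) (use finJ Z0 in auto)
  then obtain q where q: "r = p * q" by (auto elim: dvdE)
  have r0: "r \<noteq> 0" using keep by auto
  then have q0: "q \<noteq> 0" by (auto simp: q)
  have degr: "degree r = n - 1 + degree q" using degree_mult_eq[OF p0 q0] degp by (simp add: q)
  then have degq: "degree q \<le> 1" using deg k by linarith
  \<comment> \<open>Between \<open>x j\<close> and \<open>x (j+1)\<close> the factor of
    \<open>p\<close> belonging to \<open>z i\<close> changes sign only for \<open>i = j\<close>. So
    \<open>p\<close> changes sign exactly on the gaps where \<open>r\<close> does, namely those in
    \<open>J\<close>, and the cofactor \<open>q\<close> keeps its sign on every gap.\<close>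
  have step: "poly q (x j) * poly q (x (j+1)) > 0" if j: "j \<in> {1..n}" for j
  proof -
    have eq: "poly p (x j) * poly p (x (j+1)) = (\<Prod>i\<in>J. (x j - z i) * (x (j+1) - z i))"
      by (simp add: p prod.distrib)
    have pos: "(x j - z i) * (x (j+1) - z i) > 0" if "i \<in> J" "i \<noteq> j" for i
    proof (cases "i < j")
      case True
      then show ?thesis using that j below[of i j] below[of i "j+1"] by (auto intro!: mult_pos_pos)
    next
      case False
      then show ?thesis using that j above[of i j] above[of i "j+1"] by (auto intro!: mult_neg_neg)
    qed
    have rr: "poly r (x j) * poly r (x (j+1)) =
        (poly p (x j) * poly p (x (j+1))) * (poly q (x j) * poly q (x (j+1)))"
      by (simp add: q)
    show ?thesis
    proof (cases "j = k")
      case True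
      have "poly p (x j) * poly p (x (j+1)) > 0"
        unfolding eq by (intro prod_pos) (use pos True in \<open>auto simp: J_def\<close>)
      then show ?thesis using keep rr True by (metis zero_less_mult_pos)
    next
      case False
      then have jJ: "j \<in> J" using j by (auto simp: J_def)
      have "(\<Prod>i\<in>J-{j}. (x j - z i) * (x (j+1) - z i)) > 0"
        by (intro prod_pos) (use pos in auto)
      moreover have "(x j - z j) * (x (j+1) - z j) < 0"
        using z[OF jJ] by (intro mult_neg_pos) auto
      ultimately have "poly p (x j) * poly p (x (j+1)) < 0"
        unfolding eq prod.remove[OF finJ jJ] by (rule mult_neg_pos[rotated])
      moreover have "poly r (x j) * poly r (x (j+1)) < 0"
        using change jJ by (simp add: J_def)
      ultimately show ?thesis unfolding rr by (metis mult_less_0_iff less_asym)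
    qed
  qed
  \<comment> \<open>The sign is carried along the points from \<open>x 1\<close>. Starting at
    \<open>j = 0\<close> makes the base case a square, which is nonzero by \<open>step\<close> at 1.
    The case \<open>j = n\<close> then compares the two end points, enough for a \<open>q\<close> of
    degree at most 1.\<close>
  have "poly q (x 1) * poly q (x (j+1)) > 0" if "j \<le> n" for j
    using that
  proof (induction j)
    case 0
    have "poly q (x 1) \<noteq> 0" using step[of 1] k by auto
    then show ?case by (simp add: zero_less_mult_iff) linarith
  next
    case (Suc j)
    then show ?case using step[of "Suc j"] by (auto simp: zero_less_mult_iff)
  qed
  then have "poly q (x 1) * poly q (x (n+1)) > 0" by blast
  then have qnz: "poly q t \<noteq> 0" if "x 1 \<le> t" "t \<le> x (n+1)" for t
    using degree_le_1_no_root_between[OF degq] that by blast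
  show "\<forall>t\<in>{x k..x (k+1)}. poly r t \<noteq> 0"
  proof
    fix t assume t: "t \<in> {x k..x (k+1)}"
    then have "x 1 \<le> t" "t \<le> x (n+1)"
      using le[of 1 k] le[of "k+1" "n+1"] k by auto
    moreover have "t \<notin> ?Z" using Zloc t by fastforce
    ultimately show "poly r t \<noteq> 0" using qnz proots by (simp add: q)
  qed
  show "card {t. poly r t = 0} = degree r"
  proof -
    have split: "{t. poly r t = 0} = ?Z \<union> {t. poly q t = 0}" using proots by (auto simp: q)
    \<comment> \<open>A root of \<open>q\<close> lies outside the closed interval from
      \<open>x 1\<close> to \<open>x (n+1)\<close>, whereas \<open>?Z\<close> lies inside it. So the
      root counts of \<open>p\<close> and \<open>q\<close> add up, like their degrees.\<close>
    have "?Z \<inter> {t. poly q t = 0} = {}"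
    proof -
      have "x 1 \<le> t \<and> t \<le> x (n+1)" if "t \<in> ?Z" for t
        using that Zloc le[of 1 "k+1"] le[of k "n+1"] k by fastforce
      then show ?thesis using qnz by blast
    qed
    moreover have "card {t. poly q t = 0} = degree q"
    proof (cases "degree q = 0")
      case True
      then show ?thesis using q0 by (auto elim!: degree_eq_zeroE)
    next
      case False
      then have "degree q = 1" using degq by simp
      then obtain c d where qcd: "q = [:c, d:]" "d \<noteq> 0" by (metis degree1_coeffs)
      then have "{t. poly q t = 0} = {- c / d}" by (auto simp: field_simps)
      then show ?thesis using \<open>degree q = 1\<close> by simp
    qed
    ultimately show ?thesis
      unfolding split using finJ poly_roots_finite[OF q0] cardZ degr by (simp add: card_Un_disjoint)
  qed
qed

section \<open>From the alternating set to the sign pattern, and back to complex roots\<close>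

theorem theorem3p4:
  fixes e C :: "real set" and x0 :: real and n k :: nat
    and R :: "complex poly" and x :: "nat \<Rightarrow> real"
  assumes "compact e" and "infinite e"
    and "C \<in> components (- e)" and "bounded C" and "x0 \<in> C"
    and "n \<ge> 1"
    and "residual_poly e x0 n R"
    and "alternating_set e x0 n R k x" and "1 \<le> k" and "k \<le> n"
  shows "(card {t \<in> {Inf e<..<x k} \<union> {x (k+1)<..<Sup e}. poly R (of_real t) = 0} \<ge> n - 1
            \<and> (\<forall>t\<in>{x k..x (k+1)}. poly R (of_real t) \<noteq> 0))
         \<and> (degree R = n \<or> degree R = n - 1)
         \<and> (\<forall>z. poly R z = 0 \<longrightarrow> z \<in> \<real> \<and> order z R = 1)"
proof -
  define N where "N = sup_norm e R"
  define s where "s j = (-1) powi (int k + 1 - int j) * sgn (x j - x0)" for j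
  have k: "1 \<le> k" "k \<le> n" by fact+
  have deg: "degree R \<le> n" and mono: "strict_mono_on {1..n+1} x" and xe: "x ` {1..n+1} \<subseteq> e"
    and left: "\<And>j. j \<in> {1..k} \<Longrightarrow> x j < x0" and right: "\<And>j. j \<in> {k+1..n+1} \<Longrightarrow> x0 < x j"
    and val: "\<And>j. j \<in> {1..n+1} \<Longrightarrow> poly R (of_real (x j)) = of_real (s j * N)"
    using assms(8) by (auto simp: alternating_set_def s_def N_def)
  \<comment> \<open>The value 1 at \<open>x0\<close> excludes the zero polynomial.\<close>
  have R0: "R \<noteq> 0" using assms(7) by (auto simp: residual_poly_def is_arg_min_def)
  have inj: "inj_on x {1..n+1}" by (rule strict_mono_on_imp_inj_on[OF mono])
  then have card_x: "card (x ` {1..n+1}) = n + 1" by (simp add: card_image)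
  define r where "r = map_poly Re R"
  have R: "R = map_poly of_real r"
    unfolding r_def
    by (rule real_coeffs_of_real_values[of _ "x ` {1..n+1}"]) (use deg val card_x in auto)
  have Rr: "poly R (of_real t) = of_real (poly r t)" for t
    by (simp add: R poly_map_poly_of_real)
  have degR: "degree R = degree r" unfolding R by (rule degree_map_poly) simp
  have rval: "poly r (x j) = s j * N" if "j \<in> {1..n+1}" for j
    using val[OF that] unfolding Rr of_real_eq_iff .
  \<comment> \<open>If the norm vanished, \<open>r\<close> would have \<open>n + 1\<close> roots
    with degree at most \<open>n\<close>. Strict signs at the alternation points depend on excluding
    this.\<close>
  have "N \<noteq> 0"
  proof
    assume "N = 0"
    then have "r = 0"
      using rval card_x deg degR by (intro poly_eqI_degree[of "x ` {1..n+1}"]) auto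
    then show False using R0 R by simp
  qed
  then have N2: "N * N > 0" by (simp add: zero_less_mult_iff) linarith
  have prod: "poly r (x j) * poly r (x (j+1)) = (s j * s (j+1)) * (N * N)" if "j \<in> {1..n}" for j
    using rval[of j] rval[of "j+1"] that by simp
  have pw: "(-1 :: real) powi (int k + 1 - int j) * (-1) powi (int k + 1 - int (j+1)) = -1" for j
    by (simp add: power_int_minus_left)
  \<comment> \<open>The power of -1 flips at every step, while the \<open>sgn\<close> factor flips
    only when passing \<open>x0\<close>, that is at \<open>j = k\<close>. There the two flips
    cancel.\<close>
  have ss: "s j * s (j+1) = (if j = k then 1 else -1)" if j: "j \<in> {1..n}" for j
  proof -
    have "sgn (x j - x0) * sgn (x (j+1) - x0) = (if j = k then -1 else 1)"
    proof (cases j k rule: linorder_cases)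
      case less
      then show ?thesis using left[of j] left[of "j+1"] j by simp
    next
      case equal
      then show ?thesis using left[of j] right[of "j+1"] j by simp
    next
      case greater
      then show ?thesis using right[of j] right[of "j+1"] j by simp
    qed
    then show ?thesis using pw[of j] unfolding s_def
      by (metis (no_types, lifting) mult.assoc mult.left_commute mult_1 mult_minus1 minus_minus)
  qed
  have change: "poly r (x j) * poly r (x (j+1)) < 0" if "j \<in> {1..n} - {k}" for j
    using that prod[of j] ss[of j] N2 by simp
  have keep: "poly r (x k) * poly r (x (k+1)) > 0"
    using k prod[of k] ss[of k] N2 by simp
  note roots = sign_pattern_roots[OF mono k deg[unfolded degR] change keep]
  obtain Z where Z: "Z \<subseteq> {x 1<..<x k} \<union> {x (k+1)<..<x (n+1)}" "card Z = n - 1" "\<forall>t\<in>Z. poly r t = 0"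
    using roots(1) by blast
  have r0: "r \<noteq> 0" using R0 R by auto
  have "Inf e \<le> x 1" "x (n+1) \<le> Sup e"
    using xe compact_imp_bounded[OF assms(1)]
    by (auto intro!: cInf_lower cSup_upper bounded_imp_bdd_below bounded_imp_bdd_above)
  then have "Z \<subseteq> {t \<in> {Inf e<..<x k} \<union> {x (k+1)<..<Sup e}. poly R (of_real t) = 0}"
    using Z by (fastforce simp: Rr)
  moreover have "finite {t \<in> {Inf e<..<x k} \<union> {x (k+1)<..<Sup e}. poly R (of_real t) = 0}"
    using poly_roots_finite[OF r0] by (rule rev_finite_subset) (auto simp: Rr)
  ultimately have a1: "card {t \<in> {Inf e<..<x k} \<union> {x (k+1)<..<Sup e}. poly R (of_real t) = 0} \<ge> n - 1"
    using card_mono Z(2) by metis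
  have a2: "\<forall>t\<in>{x k..x (k+1)}. poly R (of_real t) \<noteq> 0" using roots(2) by (simp add: Rr)
  \<comment> \<open>By the root count the degree is the number of real roots, and \<open>Z\<close>
    supplies \<open>n - 1\<close> of them.\<close>
  have "n - 1 \<le> degree R"
    using card_mono[of "{t. poly r t = 0}" Z] poly_roots_finite[OF r0] Z(2,3) roots(3) degR by auto
  then have b: "degree R = n \<or> degree R = n - 1" using deg by linarith
  let ?A = "of_real ` {t. poly r t = 0} :: complex set"
  have cardA: "card ?A = degree R"
    using roots(3) degR by (subst card_image) (auto simp: inj_on_def)
  \<comment> \<open>The real roots already number \<open>degree R\<close>, so there are no other
    complex roots. The same count makes each of them simple below.\<close>
  have A: "{z. poly R z = 0} = ?A"
    by (rule roots_eq_of_card_eq_degree[OF R0 _ cardA]) (auto simp: Rr)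
  have "z \<in> \<real> \<and> order z R = 1" if "poly R z = 0" for z
  proof
    have "z \<in> ?A" using A that by blast
    then show "z \<in> \<real>" by auto
    show "order z R = 1"
      using order_eq_1_of_card_roots_eq_degree[OF R0 _ that] A cardA by simp
  qed
  then show ?thesis using a1 a2 b by blast
qed

end
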